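(* Let $\mu$ be a centred, isotropic measure on $S^1$, and let $\varepsilon\in[0,1)$. If $$V(Z(\mu))\ge(1-\varepsilon)V(T^2),$$ then there exists a regular triangle $S$ circumscribed about $B^2$ such that $$\delta_H({\rm supp}\,\mu,{\rm supp}\,\mu_S)\le 32\varepsilon.$$
   Context: $B^2$ is the Euclidean unit disc in $\mathbb{R}^2$ centred at the origin, $S^1$ its boundary circle, and $V$ is area. A triangle is circumscribed about $B^2$ if it contains $B^2$ and each of its edges is tangent to $B^2$; $T^2$ is a regular triangle circumscribed about $B^2$. A Borel measure $\mu$ on $S^1$ is isotropic if $\int_{S^1}u\otimes u\,d\mu(u)={\rm Id}_2$ (the $2\times2$ identity matrix), and centred if $\int_{S^1}u\,d\mu(u)=0$. For a centred, isotropic measure $\mu$, with support ${\rm supp}\,\mu$, set $$Z(\mu)=\{x\in\mathbb{R}^2:\ \langle x,u\rangle\le 1\text{ for all }u\in{\rm supp}\,\mu\},$$ which is a convex body. For a regular triangle $S$ circumscribed about $B^2$ with contact points $v_0,v_1,v_2\in S^1$, set $\mu_S=\sum_{i=0}^2\frac{2}{3}\delta[v_i]$, where $\delta[v]$ is the Dirac measure at $v$; thus ${\rm supp}\,\mu_S=\{v_0,v_1,v_2\}$. For non-empty compact $X,Y\subset S^1$, $$\delta_H(X,Y)=\max\left\{\max_{x\in X}\min_{y\in Y}\angle(x,y),\ \max_{y\in Y}\min_{x\in X}\angle(x,y)\right\},$$ where $\angle(x,y)$ is the geodesic distance on $S^1$. *)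

theory Defs
  imports "HOL-Probability.Giry_Monad"
begin

abbreviation circle :: "(real^2) set" where
  "circle \<equiv> sphere 0 1"

abbreviation disc :: "(real^2) set" where
  "disc \<equiv> cball 0 1"

abbreviation circle_borel :: "(real^2) measure" where
  "circle_borel \<equiv> restrict_space borel circle"

definition tensor :: "real^2 \<Rightarrow> real^2 \<Rightarrow> real^2^2" where
  "tensor u v = (\<chi> i j. u $ i * v $ j)"

text \<open>Unlike an equation for the Bochner integral, \<open>has_bochner_integral\<close> includes
  integrability. Taking traces in the isotropy condition shows that an isotropic measure has
  total mass 2, so finiteness need not be required separately.\<close>

definition isotropic :: "(real^2) measure \<Rightarrow> bool" where
  "isotropic \<mu> \<longleftrightarrow> has_bochner_integral \<mu> (\<lambda>u. tensor u u) (mat 1)"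

definition centred :: "(real^2) measure \<Rightarrow> bool" where
  "centred \<mu> \<longleftrightarrow> has_bochner_integral \<mu> (\<lambda>u. u) 0"

definition supp :: "'a::topological_space measure \<Rightarrow> 'a set" where
  "supp \<mu> = {x \<in> space \<mu>. \<forall>U. open U \<longrightarrow> x \<in> U \<longrightarrow> emeasure \<mu> (U \<inter> space \<mu>) > 0}"

definition Z :: "(real^2) measure \<Rightarrow> (real^2) set" where
  "Z \<mu> = {x. \<forall>u \<in> supp \<mu>. x \<bullet> u \<le> 1}"

abbreviation area :: "(real^2) set \<Rightarrow> real" where
  "area \<equiv> measure lborel"

definition regular_triangle :: "(real^2) set \<Rightarrow> bool" where
  "regular_triangle S \<longleftrightarrow>
     (\<exists>a b c. a \<noteq> b \<and> dist a b = dist b c \<and> dist b c = dist c a \<and> S = convex hull {a, b, c})"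

definition tangent_to_disc :: "(real^2) set \<Rightarrow> bool" where
  "tangent_to_disc F \<longleftrightarrow> (\<exists>v \<in> F. affine hull F \<inter> disc = {v})"

definition circumscribed_triangle :: "(real^2) set \<Rightarrow> bool" where
  "circumscribed_triangle S \<longleftrightarrow>
     2 simplex S \<and> disc \<subseteq> S \<and> (\<forall>F. F edge_of S \<longrightarrow> tangent_to_disc F)"

definition contact_points :: "(real^2) set \<Rightarrow> (real^2) set" where
  "contact_points S = frontier S \<inter> circle"

text \<open>\<open>return circle_borel v\<close> is the Dirac measure at \<open>v\<close>. The definition is only meaningful
  if \<open>S\<close> has finitely many contact points, as a circumscribed triangle does.\<close>

definition contact_measure :: "(real^2) set \<Rightarrow> (real^2) measure" where
  "contact_measure S = measure_of circle (sets circle_borel)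
     (\<lambda>A. \<Sum>v\<in>contact_points S. 2 / 3 * emeasure (return circle_borel v) A)"

text \<open>The geodesic distance on the circle, for unit vectors \<open>x\<close> and \<open>y\<close>.\<close>

definition angle :: "real^2 \<Rightarrow> real^2 \<Rightarrow> real" where
  "angle x y = arccos (x \<bullet> y)"

text \<open>Meant for non-empty compact subsets of the circle, where the suprema and infima are
  maxima and minima.\<close>

definition hausdorff_dist :: "(real^2) set \<Rightarrow> (real^2) set \<Rightarrow> real" where
  "hausdorff_dist X Y =
     max (SUP x\<in>X. INF y\<in>Y. angle x y) (SUP y\<in>Y. INF x\<in>X. angle x y)"

end

theory Submission
  imports Defs
begin

text \<open>
  The area of the body cut out by the tangents at the support is governed by the gaps between
  neighbouring support points: a gap of length \<open>2 x\<close> contributes the area \<open>tan x\<close> of a kite (lemma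
  \<open>cut_sector\<close>), and the half-gaps \<open>x\<close> add up to \<open>\<pi>\<close>. Being centred and isotropic means that \<open>\<mu>\<close>
  integrates quadratic polynomials like a rotation invariant measure, and a suitable non-negative quadratic
  polynomial shows that no gap exceeds \<open>2\<pi>/3\<close> (lemma \<open>support_gap\<close>). On \<open>[0, \<pi>/3]\<close> the convex
  function \<open>tan x\<close> lies below its chord \<open>3 \<surd>3 x / \<pi>\<close>, so the total area is at most \<open>3 \<surd>3\<close>,
  the area of the regular triangle around the disc.

  The same argument is quantitative. If the area is at least \<open>(1 - \<epsilon>) 3 \<surd>3\<close>, then no single gap
  can lie below the chord by more than \<open>3 \<surd>3 \<epsilon>\<close>. Since the distance from the chord grows
  linearly at both ends of the interval, the distance between any two support points at most
  \<open>2\<pi>/3\<close> apart is within order \<open>\<epsilon>\<close> of 0 or of \<open>2\<pi>/3\<close> (lemma \<open>gap_dichotomy\<close>). The two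
  points need not be neighbours, because the bound for the rest of the circle only uses some chain of support
  points with steps of at most \<open>2\<pi>/3\<close>.

  It remains to place the triangle. For large \<open>\<epsilon>\<close> any position will do. For small \<open>\<epsilon>\<close> there are
  support points \<open>t\<close> and \<open>p\<close> nearly \<open>2\<pi>/3\<close> apart, and the triangle with contact point
  \<open>t\<close> works: comparing another support point with \<open>t\<close> or \<open>p\<close> by the dichotomy puts it near a contact point,
  and the bound on the gaps provides support points near all three (lemma \<open>regular_triangle_close\<close>).
\<close>

section \<open>Directions and sectors of the plane\<close>

definition dir :: "real \<Rightarrow> real^2" where
  "dir t = vector [cos t, sin t]"

lemma dir_nth [simp]: "dir t $ 1 = cos t" "dir t $ 2 = sin t"
  by (simp_all add: dir_def)

lemma inner_real2: "(x::real^2) \<bullet> y = x $ 1 * y $ 1 + x $ 2 * y $ 2"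
  by (simp add: inner_vec_def sum_2)

lemma inner_dir: "dir s \<bullet> dir t = cos (s - t)"
  by (simp add: inner_real2 cos_diff)

lemma norm_dir [simp]: "norm (dir t) = 1"
  by (simp add: norm_eq_sqrt_inner inner_dir)

lemma dir_periodic [simp]: "dir (t + 2 * pi) = dir t"
  by (simp add: vec_eq_iff forall_2)

text \<open>The starting angle \<open>a\<close> is free so that the range of angles can begin at a chosen point of the
  support.\<close>

lemma polar_coordinates:
  fixes x :: "real^2"
  obtains t where "a \<le> t" "t < a + 2 * pi" "x = norm x *\<^sub>R dir t"
proof (cases "x = 0")
  case True
  then show ?thesis using that[of a] by simp
next
  case False
  define c where "c = (x $ 1 * cos a + x $ 2 * sin a) / norm x"
  define s where "s = (x $ 2 * cos a - x $ 1 * sin a) / norm x"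
  have n: "norm x \<noteq> 0" "(norm x)\<^sup>2 = (x $ 1)\<^sup>2 + (x $ 2)\<^sup>2"
    using False by (auto simp: power2_norm_eq_inner inner_real2 power2_eq_square[of "x $ _"])
  have "(x $ 1 * cos a + x $ 2 * sin a)\<^sup>2 + (x $ 2 * cos a - x $ 1 * sin a)\<^sup>2
      = ((x $ 1)\<^sup>2 + (x $ 2)\<^sup>2) * ((cos a)\<^sup>2 + (sin a)\<^sup>2)" by algebra
  then have "c\<^sup>2 + s\<^sup>2 = 1"
    using n(1) by (simp add: c_def s_def power_divide flip: add_divide_distrib n(2))
  then obtain t where t: "0 \<le> t" "t < 2 * pi" "c = cos t" "s = sin t"
    by (rule sincos_total_2pi)
  have cs: "norm x * c = x $ 1 * cos a + x $ 2 * sin a" "norm x * s = x $ 2 * cos a - x $ 1 * sin a"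
    using n by (simp_all add: c_def s_def)
  have "norm x * (cos a * c - sin a * s) = x $ 1 * ((cos a)\<^sup>2 + (sin a)\<^sup>2)"
    using cs by algebra
  moreover have "norm x * (sin a * c + cos a * s) = x $ 2 * ((cos a)\<^sup>2 + (sin a)\<^sup>2)"
    using cs by algebra
  ultimately have "x = norm x *\<^sub>R dir (a + t)"
    by (simp add: vec_eq_iff forall_2 t cos_add sin_add)
  then show ?thesis using that[of "a + t"] t by simp
qed

lemma circle_direction:
  assumes "x \<in> circle"
  obtains t where "a \<le> t" "t < a + 2 * pi" "x = dir t"
  using polar_coordinates[of a x] assms by auto

lemma circle_direction':
  assumes "x \<in> circle"
  obtains t where "a < t" "t \<le> a + 2 * pi" "x = dir t"
proof -
  obtain t where t: "a \<le> t" "t < a + 2 * pi" "x = dir t"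
    using circle_direction[OF assms] .
  show ?thesis
    using that[of t] that[of "t + 2 * pi"] t by (cases "t = a") auto
qed

definition sector :: "real \<Rightarrow> real \<Rightarrow> (real^2) set" where
  "sector a b = {r *\<^sub>R dir t | r t. 0 \<le> r \<and> a \<le> t \<and> t \<le> b}"

lemma sector_Un: "sector a c \<subseteq> sector a b \<union> sector b c"
  proof
  fix x assume "x \<in> sector a c"
  then obtain r t where "x = r *\<^sub>R dir t" "0 \<le> r" "a \<le> t" "t \<le> c"
    by (auto simp: sector_def)
  then show "x \<in> sector a b \<union> sector b c"
    by (cases "t \<le> b") (auto simp: sector_def)
qed

lemma sector_full: "x \<in> sector a (a + 2 * pi)"
proof -
  obtain t where "a \<le> t" "t < a + 2 * pi" "x = norm x *\<^sub>R dir t"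
    by (rule polar_coordinates)
  then show ?thesis unfolding sector_def by (intro CollectI exI[of _ "norm x"] exI[of _ t]) auto
qed

section \<open>Cutting a sector by the tangents at its ends\<close>

text \<open>The right triangle cut from the half-plane \<open>x \<bullet> dir a \<le> 1\<close> by the origin, the foot \<open>dir a\<close> and the
  point of the tangent line at signed distance \<open>k\<close> from the foot.\<close>

definition right_triangle :: "real \<Rightarrow> real \<Rightarrow> (real^2) set" where
  "right_triangle a k = convex hull {0, dir a, dir a + k *\<^sub>R dir (a + pi / 2)}"

lemma measure_right_triangle: "measure lborel (right_triangle a k) = \<bar>k\<bar> / 2"
proof -
  have "cos a * (sin a + k * cos a) - (cos a - k * sin a) * sin a = k * ((cos a)\<^sup>2 + (sin a)\<^sup>2)"
    by algebra
  then have "cos a * (sin a + k * cos a) - (cos a - k * sin a) * sin a = k" by simp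
  then show ?thesis
    by (simp add: right_triangle_def content_triangle cos_add sin_add abs_minus_commute)
qed

lemma right_triangle_fmeasurable [simp]: "right_triangle a k \<in> fmeasurable lborel"
  unfolding right_triangle_def
  by (intro fmeasurable_compact finite_imp_compact_convex_hull) simp

lemma mem_right_triangle:
  assumes "0 \<le> q" "q \<le> 1" "0 \<le> y" "y \<le> q"
  shows "q *\<^sub>R dir a + (y * k) *\<^sub>R dir (a + pi / 2) \<in> right_triangle a k"
proof -
  have "q *\<^sub>R dir a + (y * k) *\<^sub>R dir (a + pi / 2)
      = (1 - q) *\<^sub>R 0 + (q - y) *\<^sub>R dir a + y *\<^sub>R (dir a + k *\<^sub>R dir (a + pi / 2))"
    by (simp add: algebra_simps)
  then show ?thesis
    unfolding right_triangle_def convex_hull_3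
    using assms by (intro CollectI exI[of _ "1 - q"] exI[of _ "q - y"] exI[of _ y]) auto
qed

lemma dir_add: "dir (a + s) = cos s *\<^sub>R dir a + sin s *\<^sub>R dir (a + pi / 2)"
  by (simp add: vec_eq_iff forall_2 cos_add sin_add)

text \<open>A point in direction \<open>a + s\<close> has coordinates \<open>q = r cos s\<close> and \<open>r sin s = q tan s\<close> in the frame at
  \<open>dir a\<close>. The constraint says \<open>q \<le> 1\<close>, and \<open>tan s\<close> is a fraction of \<open>tan b\<close> by monotonicity. Negative
  \<open>b\<close> covers the half-sector on the other side of \<open>dir a\<close>.\<close>

lemma cut_half_sector:
  assumes "0 \<le> r" and "\<bar>b\<bar> < pi / 2" and "0 \<le> s \<and> s \<le> b \<or> b \<le> s \<and> s \<le> 0"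
    and "(r *\<^sub>R dir (a + s)) \<bullet> dir a \<le> 1"
  shows "r *\<^sub>R dir (a + s) \<in> right_triangle a (tan b)"
proof (cases "s = 0")
  case True
  then show ?thesis
    using mem_right_triangle[of r 0 a] assms by (simp add: inner_dir)
next
  case False
  have cs: "cos s > 0" using assms by (intro cos_gt_zero_pi) auto
  define q where "q = r * cos s"
  have q: "0 \<le> q" "q \<le> 1"
    using assms cs by (auto simp: q_def inner_dir)
  have tt: "0 \<le> tan s / tan b \<and> tan s / tan b \<le> 1 \<and> tan b \<noteq> 0"
  proof (cases "0 \<le> s")
    case True
    then have "0 < tan s" "tan s \<le> tan b"
      using False assms tan_gt_zero[of s] tan_mono_le[of s b] by auto
    then show ?thesis by simp
  next
    case f: False
    then have "0 < tan (- s)" "tan b \<le> tan s"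
      using False assms tan_gt_zero[of "- s"] tan_mono_le[of b s] by auto
    then show ?thesis by (simp add: divide_simps)
  qed
  have "r *\<^sub>R dir (a + s) = q *\<^sub>R dir a + (q * (tan s / tan b) * tan b) *\<^sub>R dir (a + pi / 2)"
    using tt cs by (subst dir_add) (simp add: q_def tan_def scaleR_right_distrib)
  also have "\<dots> \<in> right_triangle a (tan b)"
    using q tt by (intro mem_right_triangle mult_nonneg_nonneg mult_left_le) auto
  finally show ?thesis .
qed

text \<open>The two tangent lines meet on the bisector, at distance \<open>h\<close> from both feet. Each half of the
  sector is cut by the tangent at its own end.\<close>

lemma cut_sector:
  assumes "a \<le> b" "b - a < pi" 
  defines "h \<equiv> tan ((b - a) / 2)"
  shows "{x \<in> sector a b. x \<bullet> dir a \<le> 1 \<and> x \<bullet> dir b \<le> 1} \<subseteq> right_triangle a h \<union> right_triangle b (- h)"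
proof
  fix x assume "x \<in> {x \<in> sector a b. x \<bullet> dir a \<le> 1 \<and> x \<bullet> dir b \<le> 1}"
  then obtain r t where x: "x = r *\<^sub>R dir t" "0 \<le> r" "a \<le> t" "t \<le> b" "x \<bullet> dir a \<le> 1" "x \<bullet> dir b \<le> 1"
    by (auto simp: sector_def)
  show "x \<in> right_triangle a h \<union> right_triangle b (- h)"
  proof (cases "t \<le> (a + b) / 2")
    case True
    then have "r *\<^sub>R dir (a + (t - a)) \<in> right_triangle a (tan ((b - a) / 2))"
      using x assms by (intro cut_half_sector) auto
    then show ?thesis using x by (simp add: h_def)
  next
    case False
    then have "r *\<^sub>R dir (b + (t - b)) \<in> right_triangle b (tan (- ((b - a) / 2)))"
      using x assms by (intro cut_half_sector) (auto simp: field_simps)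
    then show ?thesis using x by (simp add: h_def)
  qed
qed

section \<open>Gaps in the support of a centred isotropic measure\<close>

lemma space_circle_measure: "sets \<mu> = sets circle_borel \<Longrightarrow> space \<mu> = circle"
  by (metis sets_eq_imp_space_eq space_restrict_space space_borel Int_UNIV_right)

lemma supp_eq: "supp M = space M - \<Union>{U. open U \<and> emeasure M (U \<inter> space M) = 0}"
  by (auto simp: supp_def zero_less_iff_neq_zero)

lemma closed_supp:
  assumes "sets \<mu> = sets circle_borel"
  shows "closed (supp \<mu>)"
  unfolding supp_eq using assms
  by (intro closed_Diff open_Union) (auto simp: space_circle_measure)

text \<open>The complement of the support is a union of open null sets, of which countably many suffice by
  Lindelof's theorem.\<close>

lemma AE_in_supp:
  assumes "sets \<mu> = sets circle_borel"
  shows "AE u in \<mu>. u \<in> supp \<mu>"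
proof -
  let ?F = "{U. open U \<and> emeasure \<mu> (U \<inter> space \<mu>) = 0}"
  obtain F where F: "F \<subseteq> ?F" "countable F" "\<Union>F = \<Union>?F"
    by (rule Lindelof[of ?F], simp, rule that)
  have "U \<inter> space \<mu> \<in> null_sets \<mu>" if "U \<in> F" for U
  proof -
    have "U \<in> sets borel" using that F(1) by auto
    then have "U \<inter> space \<mu> \<in> sets \<mu>"
      unfolding assms sets_restrict_space space_circle_measure[OF assms] by blast
    then show ?thesis using that F(1) by auto
  qed
  then have "(\<Union>U\<in>F. U \<inter> space \<mu>) \<in> null_sets \<mu>"
    using F(2) by (intro null_sets_UN') auto
  moreover have "{u \<in> space \<mu>. u \<notin> supp \<mu>} \<subseteq> (\<Union>U\<in>F. U \<inter> space \<mu>)"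
    using F(3) by (auto simp: supp_eq)
  ultimately show ?thesis by (rule AE_I')
qed

lemma second_moments:
  assumes "isotropic \<mu>"
  shows "has_bochner_integral \<mu> (\<lambda>u. (u \<bullet> v) * (u \<bullet> w)) (v \<bullet> w)"
proof -
  have c: "has_bochner_integral \<mu> (\<lambda>u. u $ i * u $ j) (if i = j then 1 else 0)" for i j :: 2
    using has_bochner_integral_bounded_linear[OF
        bounded_linear_compose[OF bounded_linear_vec_nth[of j] bounded_linear_vec_nth[of i]]
        assms[unfolded isotropic_def]]
    by (simp add: tensor_def mat_def)
  have "has_bochner_integral \<mu>
      (\<lambda>u. (v $ 1 * w $ 1) * (u $ 1 * u $ 1) + (v $ 1 * w $ 2) * (u $ 1 * u $ 2)
         + (v $ 2 * w $ 1) * (u $ 2 * u $ 1) + (v $ 2 * w $ 2) * (u $ 2 * u $ 2))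
      ((v $ 1 * w $ 1) * 1 + (v $ 1 * w $ 2) * 0 + (v $ 2 * w $ 1) * 0 + (v $ 2 * w $ 2) * 1)"
    using c[of 1 1] c[of 1 2] c[of 2 1] c[of 2 2]
    by (intro has_bochner_integral_add has_bochner_integral_mult_right) simp_all
  then show ?thesis
    by (simp add: inner_real2 algebra_simps)
qed

lemma first_moments:
  assumes "centred \<mu>"
  shows "has_bochner_integral \<mu> (\<lambda>u. u \<bullet> v) 0"
proof -
  have "has_bochner_integral \<mu> (\<lambda>u. u \<bullet> v) (0 \<bullet> v)"
    using assms unfolding centred_def by (intro has_bochner_integral_inner_left)
  then show ?thesis by simp
qed

lemma total_mass:
  assumes "sets \<mu> = sets circle_borel" "isotropic \<mu>"
  shows "has_bochner_integral \<mu> (\<lambda>u. 1) (2::real)"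
proof -
  have "has_bochner_integral \<mu>
      (\<lambda>u. (u \<bullet> axis 1 1) * (u \<bullet> axis 1 1) + (u \<bullet> axis 2 1) * (u \<bullet> axis 2 1)) (1 + 1)"
    using second_moments[OF assms(2), of "axis 1 1" "axis 1 1"]
      second_moments[OF assms(2), of "axis 2 1" "axis 2 1"]
    by (intro has_bochner_integral_add) (simp_all add: inner_axis_axis)
  moreover have "(u \<bullet> axis 1 1) * (u \<bullet> axis 1 1) + (u \<bullet> axis 2 1) * (u \<bullet> axis 2 1) = 1"
    if "u \<in> space \<mu>" for u
  proof -
    have "u \<bullet> u = 1"
      using that assms(1) by (simp add: space_circle_measure dot_square_norm)
    then show ?thesis by (simp add: inner_axis inner_real2[of u u])
  qed
  ultimately show ?thesis
    by (subst (asm) has_bochner_integral_cong) auto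
qed

lemma cos_le_half:
  assumes "pi / 3 < s" "s \<le> 5 * pi / 3"
  shows "cos s \<le> 1 / 2" "cos s = 1 / 2 \<Longrightarrow> s = 5 * pi / 3"
proof -
  have *: "cos s < 1 / 2" if "s < 5 * pi / 3"
  proof (cases "s \<le> pi")
    case True
    then show ?thesis using cos_monotone_0_pi[of "pi / 3" s] assms by (simp add: cos_60)
  next
    case False
    then show ?thesis
      using cos_monotone_0_pi[of "pi / 3" "2 * pi - s"] that by (simp add: cos_60 cos_diff)
  qed
  have "cos (2 * pi - pi / 3) = 1 / 2" by (subst cos_diff) (simp add: cos_60)
  then have "cos (5 * pi / 3) = 1 / 2" by simp
  then show "cos s \<le> 1 / 2" "cos s = 1 / 2 \<Longrightarrow> s = 5 * pi / 3"
    using * assms by (cases "s = 5 * pi / 3"; force)+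
qed

text \<open>Let \<open>v\<close> be the midpoint of an arc of length \<open>2\<pi>/3\<close> and \<open>w\<close> its image under a quarter turn. If
  the arc misses the support, then \<open>-1 \<le> u \<bullet> v \<le> 1/2\<close> on the support, so that the quadratic function
  \<open>(1/2 - u \<bullet> v) (u \<bullet> v + 1)\<close> is non-negative there. The moments of \<open>\<mu>\<close> give it integral
  \<open>1/2 * 2 - 0 - 1 = 0\<close>, so it vanishes almost everywhere. The arc is half-open and misses its final end
  point, which leaves only \<open>- v\<close> and the initial end point, two points of one affine line that avoids the
  origin. The affine function defining this line has zero mean on one hand and mean twice its value at the
  origin on the other, which is a contradiction. Allowing the initial end point matters: the support
  of the extremal measure has gaps of length exactly \<open>2\<pi>/3\<close>.\<close>

lemma support_gap:
  assumes "sets \<mu> = sets circle_borel" "centred \<mu>" "isotropic \<mu>"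
  shows "\<exists>s. t < s \<and> s \<le> t + 2 * pi / 3 \<and> dir s \<in> supp \<mu>"
proof (rule ccontr)
  assume gap: "\<not> ?thesis"
  define v where "v = dir (t + pi / 3)"
  define w where "w = dir (t + pi / 3 + pi / 2)"
  have *: "u \<bullet> v \<le> 1 / 2 \<and> - 1 \<le> u \<bullet> v \<and>
      (u \<bullet> v = 1 / 2 \<or> u \<bullet> v = - 1 \<longrightarrow> sqrt 3 * (u \<bullet> w) + u \<bullet> v + 1 = 0)"
    if u: "u \<in> supp \<mu>" for u
  proof -
    have "u \<in> circle" using u assms(1) by (simp add: supp_def space_circle_measure)
    then obtain s where s: "t < s" "s \<le> t + 2 * pi" "u = dir s"
      using circle_direction' by metis
    define p where "p = s - (t + pi / 3)"
    have p: "pi / 3 < p" "p \<le> 5 * pi / 3"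
    proof -
      have "t + 2 * pi / 3 < s" using gap s u not_le by blast
      then show "pi / 3 < p" "p \<le> 5 * pi / 3" using s by (auto simp: p_def)
    qed
    have "u \<bullet> v = cos (s - (t + pi / 3))" "u \<bullet> w = cos (s - (t + pi / 3) - pi / 2)"
      unfolding s v_def w_def inner_dir by (simp_all add: diff_diff_eq)
    then have uv: "u \<bullet> v = cos p" "u \<bullet> w = sin p"
      by (simp_all add: cos_diff[of p] flip: p_def)
    have "sin (2 * pi - pi / 3) = - sqrt 3 / 2" by (subst sin_diff) (simp add: sin_60)
    then have "sin (5 * pi / 3) = - sqrt 3 / 2" by simp
    then have "cos p = 1 / 2 \<Longrightarrow> sin p = - sqrt 3 / 2" using cos_le_half(2)[OF p] by simp
    moreover have "cos p = - 1 \<Longrightarrow> sin p = 0"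
      using sin_cos_squared_add[of p] by simp
    ultimately show ?thesis using cos_le_half(1)[OF p] by (auto simp: uv)
  qed
  have one: "has_bochner_integral \<mu> (\<lambda>u. 1) (2::real)" using total_mass assms by blast
  have vv: "has_bochner_integral \<mu> (\<lambda>u. (u \<bullet> v) * (u \<bullet> v)) 1"
    using second_moments[OF assms(3), of v v] by (simp add: v_def inner_dir)
  let ?f = "\<lambda>u. 1 / 2 * 1 - 1 / 2 * (u \<bullet> v) - (u \<bullet> v) * (u \<bullet> v)"
  have f: "has_bochner_integral \<mu> ?f (1 / 2 * 2 - 1 / 2 * 0 - 1)"
    using assms(2) by (intro has_bochner_integral_diff has_bochner_integral_mult_right one vv first_moments)
  have f_eq: "?f u = (1 / 2 - u \<bullet> v) * (u \<bullet> v + 1)" for u by (simp add: algebra_simps)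
  have "AE u in \<mu>. 0 \<le> ?f u"
    using AE_in_supp[OF assms(1)]
  proof eventually_elim
    case (elim u)
    then have "0 \<le> 1 / 2 - u \<bullet> v" "0 \<le> u \<bullet> v + 1" using *[of u] by linarith+
    then show ?case unfolding f_eq by (rule mult_nonneg_nonneg)
  qed
  then have "AE u in \<mu>. ?f u = 0"
    using f by (subst integral_nonneg_eq_0_iff_AE[symmetric]) (auto simp: has_bochner_integral_iff)
  with AE_in_supp[OF assms(1)] have z: "AE u in \<mu>. sqrt 3 * (u \<bullet> w) + u \<bullet> v + 1 = 0"
  proof eventually_elim
    case (elim u)
    then have "u \<bullet> v = 1 / 2 \<or> u \<bullet> v = - 1" unfolding f_eq by auto
    then show ?case using * elim by blast
  qed
  have "has_bochner_integral \<mu> (\<lambda>u. sqrt 3 * (u \<bullet> w) + u \<bullet> v + 1) (sqrt 3 * 0 + 0 + 2)"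
    using assms(2) by (intro has_bochner_integral_add has_bochner_integral_mult_right one first_moments)
  then have "(\<integral>u. sqrt 3 * (u \<bullet> w) + u \<bullet> v + 1 \<partial>\<mu>) = 2" by (simp add: has_bochner_integral_iff)
  moreover have "(\<integral>u. sqrt 3 * (u \<bullet> w) + u \<bullet> v + 1 \<partial>\<mu>) = 0" by (rule integral_eq_zero_AE[OF z])
  ultimately show False by simp
qed

section \<open>The deficit of the tangent below its chords\<close>

text \<open>Convexity of the tangent on \<open>[0, \<pi>/2)\<close>.\<close>

lemma tan_below_chord:
  assumes "0 \<le> u" "u < v" "v < pi / 2" "u \<le> x" "x \<le> v"
  shows "tan x \<le> (tan v - tan u) / (v - u) * (x - u) + tan u"
proof -
  have c: "cos y > 0" if "y \<in> {u..v}" for y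
    using that assms by (intro cos_gt_zero_pi) auto
  have "convex_on {u..v} tan"
  proof (rule convex_on_realI)
    show "(tan has_real_derivative inverse ((cos y)\<^sup>2)) (at y)" if "y \<in> {u..v}" for y
      using c[OF that] by (intro DERIV_tan) simp
    show "inverse ((cos y)\<^sup>2) \<le> inverse ((cos z)\<^sup>2)" if "y \<in> {u..v}" "z \<in> {u..v}" "y \<le> z" for y z
    proof (rule le_imp_inverse_le)
      show "(cos z)\<^sup>2 \<le> (cos y)\<^sup>2"
        using that assms c[of z] by (intro power_mono cos_monotone_0_pi_le) auto
      show "0 < (cos z)\<^sup>2" using c[OF that(2)] by simp
    qed
  qed simp
  then show ?thesis using assms by (intro convex_onD_Icc') auto
qed

lemma sqrt3_gt: "173 / 100 < sqrt 3"
  by (rule real_less_rsqrt) (simp add: power2_eq_square)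

lemma pi_lt: "pi < 315 / 100"
  by (rule order_le_less_trans[OF pi_approx(2)]) simp

lemma tan_le_linear:
  assumes "0 \<le> x" "x \<le> pi / 3"
  shows "tan x \<le> 3 * sqrt 3 / pi * x"
  using tan_below_chord[of 0 "pi / 3" x] assms by (simp add: tan_60 mult.commute)

text \<open>The deficit \<open>3 \<surd>3 x / \<pi> - tan x\<close> at \<open>x = t / 2\<close> is concave and vanishes at the ends of
  \<open>[0, \<pi>/3]\<close>, so it is bounded below by the broken line through its positive value at \<open>\<pi>/4\<close>, where
  the tangent is 1. A deficit of order \<open>\<epsilon>\<close> thus forces \<open>t\<close> to lie within order \<open>\<epsilon>\<close> of an end. The
  slopes of the broken line give the factors \<open>27.3...\<close> and \<open>9.1...\<close>, rounded up here.\<close>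

lemma small_deficit_dichotomy:
  assumes "0 \<le> t" "t \<le> 2 * pi / 3"
    and deficit: "3 * sqrt 3 / (2 * pi) * t - tan (t / 2) \<le> 3 * sqrt 3 * \<epsilon>"
  shows "t \<le> 28 * \<epsilon> \<or> 2 * pi / 3 - 10 * \<epsilon> \<le> t"
proof (cases "t / 2 \<le> pi / 4")
  case True
  have "tan (t / 2) \<le> 2 * t / pi"
    using tan_below_chord[of 0 "pi / 4" "t / 2"] True assms by (simp add: tan_45)
  then have "3 * sqrt 3 / (2 * pi) * t - 2 * t / pi \<le> 3 * sqrt 3 * \<epsilon>" using deficit by linarith
  then have *: "(3 * sqrt 3 - 4) * t \<le> 6 * sqrt 3 * pi * \<epsilon>" by (simp add: field_simps)
  have "0 \<le> (3 * sqrt 3 - 4) * t" using assms sqrt3_gt by (intro mult_nonneg_nonneg) auto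
  then have e: "0 \<le> \<epsilon>"
    using * by (smt (verit) mult_pos_neg mult_pos_pos pi_gt_zero real_sqrt_gt_zero)
  have "6 * sqrt 3 * pi \<le> 6 * sqrt 3 * (315 / 100)" using pi_lt by (intro mult_left_mono) auto
  also have "\<dots> \<le> (3 * sqrt 3 - 4) * 28" using sqrt3_gt by simp
  finally have "6 * sqrt 3 * pi * \<epsilon> \<le> (3 * sqrt 3 - 4) * (28 * \<epsilon>)"
    using mult_right_mono[OF _ e] by (metis mult.assoc)
  with * have "(3 * sqrt 3 - 4) * t \<le> (3 * sqrt 3 - 4) * (28 * \<epsilon>)" by linarith
  moreover have "0 < 3 * sqrt 3 - 4" using sqrt3_gt by simp
  ultimately show ?thesis by (auto dest: mult_left_le_imp_le)
next
  case False
  define s where "s = 2 * pi / 3 - t"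
  have "tan (t / 2) \<le> (sqrt 3 - 1) / (pi / 3 - pi / 4) * (t / 2 - pi / 4) + 1"
    using tan_below_chord[of "pi / 4" "pi / 3" "t / 2"] False assms by (simp add: tan_45 tan_60)
  also have "\<dots> = sqrt 3 - 6 * (sqrt 3 - 1) * s / pi"
    by (simp add: s_def field_simps)
  finally have "3 * sqrt 3 / (2 * pi) * t - (sqrt 3 - 6 * (sqrt 3 - 1) * s / pi) \<le> 3 * sqrt 3 * \<epsilon>"
    using deficit by linarith
  then have *: "(9 * sqrt 3 - 12) * s \<le> 6 * sqrt 3 * pi * \<epsilon>" by (simp add: s_def field_simps)
  have "0 \<le> (9 * sqrt 3 - 12) * s" using assms sqrt3_gt by (intro mult_nonneg_nonneg) (auto simp: s_def)
  then have e: "0 \<le> \<epsilon>"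
    using * by (smt (verit) mult_pos_neg mult_pos_pos pi_gt_zero real_sqrt_gt_zero)
  have "6 * sqrt 3 * pi \<le> 6 * sqrt 3 * (315 / 100)" using pi_lt by (intro mult_left_mono) auto
  also have "\<dots> \<le> (9 * sqrt 3 - 12) * 10" using sqrt3_gt by simp
  finally have "6 * sqrt 3 * pi * \<epsilon> \<le> (9 * sqrt 3 - 12) * (10 * \<epsilon>)"
    using mult_right_mono[OF _ e] by (metis mult.assoc)
  with * have "(9 * sqrt 3 - 12) * s \<le> (9 * sqrt 3 - 12) * (10 * \<epsilon>)" by linarith
  moreover have "0 < 9 * sqrt 3 - 12" using sqrt3_gt by simp
  ultimately have "s \<le> 10 * \<epsilon>" by (auto dest: mult_left_le_imp_le)
  then show ?thesis by (simp add: s_def)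
qed

section \<open>The area of a polar body\<close>

lemma continuous_dir: "continuous_on UNIV dir"
proof (rule continuous_on_eq)
  show "continuous_on UNIV (\<lambda>t. cos t *\<^sub>R dir 0 + sin t *\<^sub>R dir (pi / 2))"
    by (intro continuous_intros)
qed (simp add: vec_eq_iff forall_2)

definition polar_body :: "(real^2) set \<Rightarrow> (real^2) set" where
  "polar_body K = {x. \<forall>u\<in>K. x \<bullet> u \<le> 1}"

lemma closed_polar_body: "closed (polar_body K)"
proof -
  have "polar_body K = (\<Inter>u\<in>K. {x. u \<bullet> x \<le> 1})"
    by (auto simp: polar_body_def inner_commute)
  then show ?thesis by (auto intro: closed_halfspace_le)
qed

locale gaps_at_most_third =
  fixes K :: "(real^2) set"
  assumes closed_K: "closed K"
    and gap: "\<And>t. \<exists>s. t < s \<and> s \<le> t + 2 * pi / 3 \<and> dir s \<in> K"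
begin

text \<open>Stepping to the farthest direction of \<open>K\<close> within \<open>2\<pi>/3\<close> and then to any direction of \<open>K\<close> in
  the next \<open>2\<pi>/3\<close> advances by more than \<open>2\<pi>/3\<close>, since nothing lies between the farthest one and
  \<open>x + 2\<pi>/3\<close>. So finitely many steps of length at most \<open>2\<pi>/3\<close> go around the circle, even when \<open>K\<close>
  is infinite.\<close>

lemma two_steps:
  assumes "dir x \<in> K"
  obtains p q where "dir p \<in> K" "dir q \<in> K" "x \<le> p" "p \<le> x + 2 * pi / 3" "x + 2 * pi / 3 < q"
    "q \<le> p + 2 * pi / 3"
proof -
  let ?P = "{x..x + 2 * pi / 3} \<inter> dir -` K"
  have "closed (dir -` K)" using closed_K continuous_dir by (rule closed_vimage)
  then have "compact ?P" by (intro compact_Int_closed) auto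
  moreover have "x \<in> ?P" using assms by simp
  ultimately obtain p where p: "p \<in> ?P" "\<And>s. s \<in> ?P \<Longrightarrow> s \<le> p"
    using compact_attains_sup[of ?P] by blast
  obtain q where q: "p < q" "q \<le> p + 2 * pi / 3" "dir q \<in> K" using gap by blast
  have "x + 2 * pi / 3 < q" using p(2)[of q] p(1) q by force
  then show ?thesis using that[of p q] p q by auto
qed

text \<open>Bounding the area of a measurable superset, rather than of the slice itself, spares the
  measurability of sectors.\<close>

definition area_bound :: "real \<Rightarrow> real \<Rightarrow> real \<Rightarrow> bool" where
  "area_bound a b m \<longleftrightarrow>
     (\<exists>C \<in> fmeasurable lborel. polar_body K \<inter> sector a b \<subseteq> C \<and> measure lborel C \<le> m)"

lemma area_bound_mono: "area_bound a b m \<Longrightarrow> m \<le> n \<Longrightarrow> area_bound a b n"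
  unfolding area_bound_def by (meson order_trans)

lemma area_bound_add:
  assumes "area_bound a b m" "area_bound b c n"
  shows "area_bound a c (m + n)"
proof -
  obtain C D where *: "C \<in> fmeasurable lborel" "polar_body K \<inter> sector a b \<subseteq> C" "measure lborel C \<le> m"
    "D \<in> fmeasurable lborel" "polar_body K \<inter> sector b c \<subseteq> D" "measure lborel D \<le> n"
    using assms by (auto simp: area_bound_def)
  have "measure lborel (C \<union> D) \<le> m + n"
    using measure_Un_le[OF fmeasurableD[OF *(1)] fmeasurableD[OF *(4)]] * by linarith
  moreover have "polar_body K \<inter> sector a c \<subseteq> C \<union> D"
    using sector_Un[of a c b] * by blast
  ultimately show ?thesis
    unfolding area_bound_def using * fmeasurable.Un by blast
qed

lemma area_bound_gap:
  assumes "dir a \<in> K" "dir b \<in> K" "a \<le> b" "b - a \<le> 2 * pi / 3"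
  shows "area_bound a b (tan ((b - a) / 2))"
proof -
  let ?h = "tan ((b - a) / 2)"
  let ?C = "right_triangle a ?h \<union> right_triangle b (- ?h)"
  have lt: "b - a < pi" using assms pi_gt_zero by linarith
  then have "0 \<le> ?h" using assms by (intro tan_pos_pi2_le) auto
  then have "measure lborel ?C \<le> ?h"
    using measure_Un_le[OF fmeasurableD[OF right_triangle_fmeasurable[of a ?h]]
        fmeasurableD[OF right_triangle_fmeasurable[of b "- ?h"]]]
    by (simp add: measure_right_triangle)
  moreover have "polar_body K \<inter> sector a b \<subseteq> ?C"
    using cut_sector[OF assms(3) lt] assms by (auto simp: polar_body_def)
  moreover have "?C \<in> fmeasurable lborel" by (intro fmeasurable.Un) simp_all
  ultimately show ?thesis unfolding area_bound_def by blast
qed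

lemma area_bound_gap_linear:
  assumes "dir a \<in> K" "dir b \<in> K" "a \<le> b" "b - a \<le> 2 * pi / 3"
  shows "area_bound a b (3 * sqrt 3 / (2 * pi) * (b - a))"
  using area_bound_mono[OF area_bound_gap[OF assms]] tan_le_linear[of "(b - a) / 2"] assms by simp

text \<open>The linear bound of a single gap adds up along a chain of steps of length at most \<open>2\<pi>/3\<close>.\<close>

lemma area_bound_linear:
  assumes "dir a \<in> K" "dir b \<in> K" "a \<le> b"
  shows "area_bound a b (3 * sqrt 3 / (2 * pi) * (b - a))"
proof -
  have join: "k * (y - x) + k * (z - y) = k * (z - x)" for k x y z :: real
    by (simp add: algebra_simps)
  have "area_bound a b (3 * sqrt 3 / (2 * pi) * (b - a))"
    if "dir a \<in> K" "a \<le> b" "b - a \<le> real n * (2 * pi / 3)" for a n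
    using that
  proof (induction n arbitrary: a)
    case 0
    then show ?case using area_bound_gap_linear[of a b] assms by simp
  next
    case (Suc n)
    show ?case
    proof (cases "b - a \<le> 2 * pi / 3")
      case True
      then show ?thesis using area_bound_gap_linear[of a b] assms Suc by simp
    next
      case far: False
      obtain p q where pq: "dir p \<in> K" "dir q \<in> K" "a \<le> p" "p \<le> a + 2 * pi / 3"
        "a + 2 * pi / 3 < q" "q \<le> p + 2 * pi / 3"
        using two_steps[OF Suc.prems(1)] by blast
      have ap: "area_bound a p (3 * sqrt 3 / (2 * pi) * (p - a))"
        using area_bound_gap_linear[of a p] pq Suc by simp
      have pb: "area_bound p b (3 * sqrt 3 / (2 * pi) * (b - p))"
      proof (cases "b \<le> p + 2 * pi / 3")
        case True
        then show ?thesis using area_bound_gap_linear[of p b] pq far assms by simp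
      next
        case False
        then have "b - q \<le> real n * (2 * pi / 3)" "q \<le> b"
          using pq Suc.prems by (auto simp: algebra_simps)
        then have "area_bound q b (3 * sqrt 3 / (2 * pi) * (b - q))" using Suc.IH[of q] pq by simp
        moreover have "area_bound p q (3 * sqrt 3 / (2 * pi) * (q - p))"
          using area_bound_gap_linear[of p q] pq by simp
        ultimately have "area_bound p b (3 * sqrt 3 / (2 * pi) * (q - p) + 3 * sqrt 3 / (2 * pi) * (b - q))"
          by (intro area_bound_add)
        then show ?thesis by (simp only: join)
      qed
      have "area_bound a b (3 * sqrt 3 / (2 * pi) * (p - a) + 3 * sqrt 3 / (2 * pi) * (b - p))"
        using ap pb by (rule area_bound_add)
      then show ?thesis by (simp only: join)
    qed
  qed
  moreover obtain n where "(b - a) / (2 * pi / 3) \<le> real n" using real_arch_simple by blast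
  then have "b - a \<le> real n * (2 * pi / 3)" by (simp add: field_simps)
  ultimately show ?thesis using assms by blast
qed

text \<open>The chosen gap is bounded by its kite and the rest of the circle linearly, so the distance of the
  tangent from its chord at this one gap is a deficit of the total area.\<close>

lemma area_polar_body_le:
  assumes "dir a \<in> K" "dir b \<in> K" "a \<le> b" "b - a \<le> 2 * pi / 3"
  shows "measure lborel (polar_body K) \<le> tan ((b - a) / 2) + 3 * sqrt 3 / (2 * pi) * (2 * pi - (b - a))"
proof -
  have "area_bound b (a + 2 * pi) (3 * sqrt 3 / (2 * pi) * (a + 2 * pi - b))"
    using assms by (intro area_bound_linear) auto
  from area_bound_add[OF area_bound_gap[OF assms] this]
  obtain C where "C \<in> fmeasurable lborel" "polar_body K \<subseteq> C"
    "measure lborel C \<le> tan ((b - a) / 2) + 3 * sqrt 3 / (2 * pi) * (a + 2 * pi - b)"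
    unfolding area_bound_def using sector_full[of _ a] by blast
  moreover have "measure lborel (polar_body K) \<le> measure lborel C"
    using calculation closed_polar_body by (intro measure_mono_fmeasurable) auto
  ultimately show ?thesis by (simp add: algebra_simps)
qed

lemma gap_dichotomy:
  assumes "dir a \<in> K" "dir b \<in> K" "a \<le> b" "b - a \<le> 2 * pi / 3"
    and "(1 - \<epsilon>) * (3 * sqrt 3) \<le> measure lborel (polar_body K)"
  shows "b - a \<le> 28 * \<epsilon> \<or> 2 * pi / 3 - 10 * \<epsilon> \<le> b - a"
proof (rule small_deficit_dichotomy)
  have "(1 - \<epsilon>) * (3 * sqrt 3) \<le> tan ((b - a) / 2) + 3 * sqrt 3 / (2 * pi) * (2 * pi - (b - a))"
    using area_polar_body_le[OF assms(1-4)] assms(5) by linarith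
  moreover have "3 * sqrt 3 / (2 * pi) * (2 * pi - (b - a)) = 3 * sqrt 3 - 3 * sqrt 3 / (2 * pi) * (b - a)"
    by (simp add: field_simps)
  ultimately show "3 * sqrt 3 / (2 * pi) * (b - a) - tan ((b - a) / 2) \<le> 3 * sqrt 3 * \<epsilon>"
    by (simp add: algebra_simps)
qed (use assms in auto)

end

section \<open>The area of a regular triangle around the disc\<close>

text \<open>The left-hand side is \<open>b \<bullet> m\<close> for the altitude vector \<open>m = a - (b + c) / 2\<close>, which is the minimum of
  \<open>x \<bullet> m\<close> over the triangle. The minimum over the disc is \<open>- norm m\<close>, and \<open>norm m = \<surd>3/2 s\<close>.\<close>

lemma equilateral_inner_le:
  fixes a b c :: "real^2"
  assumes "dist a b = s" "dist b c = s" "dist c a = s" "disc \<subseteq> convex hull {a, b, c}"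
  shows "b \<bullet> a - (b \<bullet> b + b \<bullet> c) / 2 \<le> - (sqrt 3 / 2 * s)"
proof (cases "s = 0")
  case True
  then show ?thesis using assms by (simp add: dist_eq_0_iff)
next
  case False
  have d: "dist x y ^ 2 = x \<bullet> x - 2 * (x \<bullet> y) + y \<bullet> y" for x y :: "real^2"
    by (simp add: dist_norm power2_norm_eq_inner inner_diff algebra_simps inner_commute)
  have s: "a \<bullet> a - 2 * (a \<bullet> b) + b \<bullet> b = s\<^sup>2" "b \<bullet> b - 2 * (b \<bullet> c) + c \<bullet> c = s\<^sup>2"
    "c \<bullet> c - 2 * (c \<bullet> a) + a \<bullet> a = s\<^sup>2"
    using assms d by metis+
  define m where "m = a - (1 / 2) *\<^sub>R (b + c)"
  have m: "x \<bullet> m = x \<bullet> a - (x \<bullet> b + x \<bullet> c) / 2" for x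
    by (simp add: m_def algebra_simps inner_diff_right inner_add_right)
  have cm: "c \<bullet> m = b \<bullet> m" "b \<bullet> m \<le> a \<bullet> m" "m \<bullet> m = 3 / 4 * s\<^sup>2"
  proof -
    have ic: "b \<bullet> a = a \<bullet> b" "c \<bullet> a = a \<bullet> c" "c \<bullet> b = b \<bullet> c"
      by (rule inner_commute)+
    show 1: "c \<bullet> m = b \<bullet> m" using s unfolding m ic by (simp add: field_simps)
    have 2: "a \<bullet> m - b \<bullet> m = 3 / 4 * s\<^sup>2" using s unfolding m ic by (simp add: field_simps)
    then show "b \<bullet> m \<le> a \<bullet> m" using zero_le_power2[of s] by linarith
    have "m \<bullet> m = a \<bullet> m - (b \<bullet> m + c \<bullet> m) / 2"
      by (subst m_def) (simp add: inner_diff_left inner_add_left)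
    then show "m \<bullet> m = 3 / 4 * s\<^sup>2" using 1 2 by simp
  qed
  have "s > 0" using False assms zero_le_dist[of a b] by linarith
  then have nm: "norm m = sqrt 3 / 2 * s"
    by (simp add: norm_eq_sqrt_inner cm real_sqrt_mult real_sqrt_divide)
  have "convex hull {a, b, c} \<subseteq> {x. m \<bullet> x \<ge> b \<bullet> m}"
    using cm by (intro hull_minimal convex_halfspace_ge) (auto simp: inner_commute)
  moreover have "- (1 / norm m) *\<^sub>R m \<in> disc" using \<open>s > 0\<close> nm by simp
  ultimately have "- (1 / norm m) *\<^sub>R m \<in> {x. m \<bullet> x \<ge> b \<bullet> m}" using assms(4) by blast
  then have "b \<bullet> m \<le> - (1 / norm m * (norm m)\<^sup>2)" by (simp add: power2_norm_eq_inner)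
  also have "\<dots> = - norm m" using \<open>s > 0\<close> nm by (simp add: power2_eq_square)
  finally show ?thesis using nm unfolding m by simp
qed

lemma area_equilateral:
  fixes a b c :: "real^2"
  assumes "dist a b = s" "dist b c = s" "dist c a = s"
  shows "area (convex hull {a, b, c}) = sqrt 3 / 4 * s\<^sup>2"
proof -
  have d: "(dist x y)\<^sup>2 = (x $ 1 - y $ 1)\<^sup>2 + (x $ 2 - y $ 2)\<^sup>2" for x y :: "real^2"
    unfolding dist_norm power2_norm_eq_inner inner_real2 by (simp add: power2_eq_square)
  define D where "D = (c $ 1 - a $ 1) * (b $ 2 - a $ 2) - (b $ 1 - a $ 1) * (c $ 2 - a $ 2)"
  have "(a $ 1 - b $ 1)\<^sup>2 + (a $ 2 - b $ 2)\<^sup>2 = s\<^sup>2" "(b $ 1 - c $ 1)\<^sup>2 + (b $ 2 - c $ 2)\<^sup>2 = s\<^sup>2"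
    "(c $ 1 - a $ 1)\<^sup>2 + (c $ 2 - a $ 2)\<^sup>2 = s\<^sup>2"
    using assms d by metis+
  \<comment> \<open>\<open>D\<close> is twice the signed area; the Gram determinant of two sides at angle \<open>\<pi>/3\<close> is \<open>3/4 s^4\<close>.\<close>
  then have "4 * D\<^sup>2 = 3 * (s\<^sup>2)\<^sup>2" unfolding D_def by algebra
  then have "D\<^sup>2 = (sqrt 3 / 2 * s\<^sup>2)\<^sup>2" by (simp add: power_mult_distrib power_divide)
  then have "\<bar>D\<bar> = \<bar>sqrt 3 / 2 * s\<^sup>2\<bar>" by (metis real_sqrt_abs)
  then show ?thesis by (simp add: content_triangle D_def)
qed

text \<open>Viviani's theorem in disguise: each of the three sides has distance at least 1 from the origin, and
  these distances add up to the altitude, which is therefore at least 3. Here the three instances of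
  \<open>equilateral_inner_le\<close> are added.\<close>

lemma area_circumscribed_ge:
  assumes "regular_triangle T" "disc \<subseteq> T"
  shows "3 * sqrt 3 \<le> area T"
proof -
  obtain a b c where T: "a \<noteq> b" "dist a b = dist b c" "dist b c = dist c a" "T = convex hull {a, b, c}"
    using assms(1) unfolding regular_triangle_def by auto
  define s where "s = dist a b"
  have s: "dist a b = s" "dist b c = s" "dist c a = s" "s > 0" using T by (auto simp: s_def)
  have h: "{b, c, a} = {a, b, c}" "{c, a, b} = {a, b, c}" by auto
  have 1: "b \<bullet> a - (b \<bullet> b + b \<bullet> c) / 2 \<le> - (sqrt 3 / 2 * s)"
    "c \<bullet> b - (c \<bullet> c + c \<bullet> a) / 2 \<le> - (sqrt 3 / 2 * s)"
    "a \<bullet> c - (a \<bullet> a + a \<bullet> b) / 2 \<le> - (sqrt 3 / 2 * s)"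
    using equilateral_inner_le[of a b s c] equilateral_inner_le[of b c s a]
      equilateral_inner_le[of c a s b] s assms(2) T h by auto
  have d: "dist x y ^ 2 = x \<bullet> x - 2 * (x \<bullet> y) + y \<bullet> y" for x y :: "real^2"
    by (simp add: dist_norm power2_norm_eq_inner inner_diff algebra_simps inner_commute)
  have 2: "a \<bullet> a - 2 * (a \<bullet> b) + b \<bullet> b = s\<^sup>2" "b \<bullet> b - 2 * (b \<bullet> c) + c \<bullet> c = s\<^sup>2"
    "c \<bullet> c - 2 * (c \<bullet> a) + a \<bullet> a = s\<^sup>2"
    using s d by metis+
  have ic: "b \<bullet> a = a \<bullet> b" "c \<bullet> a = a \<bullet> c" "c \<bullet> b = b \<bullet> c"
    by (rule inner_commute)+
  have "3 * (sqrt 3 / 2 * s) \<le> 3 / 4 * s\<^sup>2"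
    using 1 2 unfolding ic add_divide_distrib by argo
  then have "2 * sqrt 3 * s \<le> s * s" by (simp add: power2_eq_square mult.commute mult.left_commute)
  then have "2 * sqrt 3 \<le> s" using s(4) by simp
  then have "(2 * sqrt 3)\<^sup>2 \<le> s\<^sup>2" by (intro power_mono) auto
  then have "sqrt 3 / 4 * 12 \<le> sqrt 3 / 4 * s\<^sup>2" by (intro mult_left_mono) (auto simp: power_mult_distrib)
  then show ?thesis unfolding T(4) area_equilateral[OF s(1-3)] by linarith
qed

section \<open>The circumscribed regular triangle with given contact points\<close>

text \<open>Three unit vectors at mutual angle \<open>2\<pi>/3\<close>, treated symmetrically. The last assumption is isotropy
  of the uniform measure of mass 2 on them.\<close>

locale regular_triple =
  fixes v0 v1 v2 :: "real^2"
  assumes unit: "norm v0 = 1" "norm v1 = 1" "norm v2 = 1"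
    and inner: "v0 \<bullet> v1 = - 1 / 2" "v1 \<bullet> v2 = - 1 / 2" "v0 \<bullet> v2 = - 1 / 2"
    and frame: "\<And>x. (x \<bullet> v0) *\<^sub>R v0 + (x \<bullet> v1) *\<^sub>R v1 + (x \<bullet> v2) *\<^sub>R v2 = (3 / 2) *\<^sub>R x"
begin

lemma inners:
  "v0 \<bullet> v0 = 1" "v1 \<bullet> v1 = 1" "v2 \<bullet> v2 = 1"
  "v0 \<bullet> v1 = - 1 / 2" "v1 \<bullet> v0 = - 1 / 2" "v1 \<bullet> v2 = - 1 / 2" "v2 \<bullet> v1 = - 1 / 2"
  "v0 \<bullet> v2 = - 1 / 2" "v2 \<bullet> v0 = - 1 / 2"
  using unit inner by (simp_all add: dot_square_norm inner_commute)

lemma sum_zero: "v0 + v1 + v2 = 0"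
proof -
  have "(v0 + v1 + v2) \<bullet> (v0 + v1 + v2) = 0"
    by (simp add: inner_add_left inner_add_right inners)
  then show ?thesis by simp
qed

lemma distinct: "v0 \<noteq> v1" "v1 \<noteq> v2" "v0 \<noteq> v2"
  using inners by force+

definition triangle :: "(real^2) set" where
  "triangle = convex hull {- 2 *\<^sub>R v0, - 2 *\<^sub>R v1, - 2 *\<^sub>R v2}"

text \<open>The vertices are \<open>- 2 v\<close>, and \<open>(1 - v \<bullet> x) / 3\<close> are the barycentric coordinates of \<open>x\<close>: they add
  up to 1 because the three vectors sum to zero, and they reproduce \<open>x\<close> by the frame identity.\<close>

lemma mem_triangle: "x \<in> triangle \<longleftrightarrow> v0 \<bullet> x \<le> 1 \<and> v1 \<bullet> x \<le> 1 \<and> v2 \<bullet> x \<le> 1"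
proof
  have "triangle \<subseteq> {x. v0 \<bullet> x \<le> 1} \<inter> {x. v1 \<bullet> x \<le> 1} \<inter> {x. v2 \<bullet> x \<le> 1}"
    unfolding triangle_def
    by (intro hull_minimal convex_Int convex_halfspace_le) (auto simp: inners)
  then show "x \<in> triangle \<Longrightarrow> v0 \<bullet> x \<le> 1 \<and> v1 \<bullet> x \<le> 1 \<and> v2 \<bullet> x \<le> 1" by blast
next
  assume x: "v0 \<bullet> x \<le> 1 \<and> v1 \<bullet> x \<le> 1 \<and> v2 \<bullet> x \<le> 1"
  have "(v0 + v1 + v2) \<bullet> x = 0" by (simp add: sum_zero)
  then have s: "v0 \<bullet> x + v1 \<bullet> x + v2 \<bullet> x = 0" by (simp add: inner_add_left)
  have "((1 - v0 \<bullet> x) / 3) *\<^sub>R (- 2 *\<^sub>R v0) + ((1 - v1 \<bullet> x) / 3) *\<^sub>R (- 2 *\<^sub>R v1)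
      + ((1 - v2 \<bullet> x) / 3) *\<^sub>R (- 2 *\<^sub>R v2)
    = (- 2 / 3) *\<^sub>R (v0 + v1 + v2)
      + (2 / 3) *\<^sub>R ((x \<bullet> v0) *\<^sub>R v0 + (x \<bullet> v1) *\<^sub>R v1 + (x \<bullet> v2) *\<^sub>R v2)"
    by (simp add: vec_eq_iff field_simps inner_commute)
  also have "\<dots> = x" unfolding frame sum_zero by simp
  finally have "x = ((1 - v0 \<bullet> x) / 3) *\<^sub>R (- 2 *\<^sub>R v0) + ((1 - v1 \<bullet> x) / 3) *\<^sub>R (- 2 *\<^sub>R v1)
      + ((1 - v2 \<bullet> x) / 3) *\<^sub>R (- 2 *\<^sub>R v2)" ..
  then show "x \<in> triangle" unfolding triangle_def convex_hull_3
    using x s by (intro CollectI exI[of _ "(1 - v0 \<bullet> x) / 3"] exI[of _ "(1 - v1 \<bullet> x) / 3"]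
        exI[of _ "(1 - v2 \<bullet> x) / 3"]) (auto simp: field_simps)
qed

lemma disc_subset_triangle: "disc \<subseteq> triangle"
proof
  fix x :: "real^2" assume "x \<in> disc"
  then have "v \<bullet> x \<le> 1" if "norm v = 1" for v
    using norm_cauchy_schwarz[of v x] that by simp
  then show "x \<in> triangle" by (simp add: mem_triangle unit)
qed

lemma regular_triangle_triangle: "regular_triangle triangle"
proof -
  have "norm (v0 - v1) = norm (v1 - v2)" "norm (v1 - v2) = norm (v2 - v0)"
    by (simp_all add: norm_eq_sqrt_inner inner_diff_left inner_diff_right inners)
  then have "dist (- 2 *\<^sub>R v0) (- 2 *\<^sub>R v1) = dist (- 2 *\<^sub>R v1) (- 2 *\<^sub>R v2)"
    "dist (- 2 *\<^sub>R v1) (- 2 *\<^sub>R v2) = dist (- 2 *\<^sub>R v2) (- 2 *\<^sub>R v0)"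
    unfolding dist_norm by (simp_all add: norm_minus_commute flip: scaleR_diff_right)
  moreover have "- 2 *\<^sub>R v0 \<noteq> - 2 *\<^sub>R v1" using distinct by simp
  ultimately show ?thesis
    unfolding regular_triangle_def triangle_def by blast
qed

lemma affine_independent: "\<not> affine_dependent {- 2 *\<^sub>R v0, - 2 *\<^sub>R v1, - 2 *\<^sub>R v2}"
proof
  assume "affine_dependent {- 2 *\<^sub>R v0, - 2 *\<^sub>R v1, - 2 *\<^sub>R v2}"
  then obtain U where U: "sum U {- 2 *\<^sub>R v0, - 2 *\<^sub>R v1, - 2 *\<^sub>R v2} = 0"
    "\<exists>v\<in>{- 2 *\<^sub>R v0, - 2 *\<^sub>R v1, - 2 *\<^sub>R v2}. U v \<noteq> 0"
    "(\<Sum>v\<in>{- 2 *\<^sub>R v0, - 2 *\<^sub>R v1, - 2 *\<^sub>R v2}. U v *\<^sub>R v) = 0"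
    by (subst (asm) affine_dependent_explicit_finite) auto
  define p q r where "p = U (- 2 *\<^sub>R v0)" "q = U (- 2 *\<^sub>R v1)" "r = U (- 2 *\<^sub>R v2)"
  have 0: "p + (q + r) = 0" using U(1) distinct by (simp add: p_q_r_def)
  have "p *\<^sub>R (- 2 *\<^sub>R v0) + (q *\<^sub>R (- 2 *\<^sub>R v1) + r *\<^sub>R (- 2 *\<^sub>R v2)) = 0"
    using U(3) distinct by (simp add: p_q_r_def)
  then have *: "(p *\<^sub>R (- 2 *\<^sub>R v0) + (q *\<^sub>R (- 2 *\<^sub>R v1) + r *\<^sub>R (- 2 *\<^sub>R v2))) \<bullet> v = 0" for v
    by simp
  have "p = 0 \<and> q = 0 \<and> r = 0"
    using *[of v0] *[of v1] *[of v2] 0 unfolding inner_add_left inner_scaleR_left inners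
    by (intro conjI; linarith)
  then show False using U(2) by (simp add: p_q_r_def)
qed

text \<open>The edge lies on the line \<open>u2 \<bullet> x = 1\<close> and has \<open>u2\<close> as its midpoint; equality in the
  Cauchy-Schwarz inequality shows that this line meets the disc in \<open>u2\<close> only.\<close>

lemma tangent_edge:
  assumes "norm u2 = 1" "u0 \<bullet> u2 = - 1 / 2" "u1 \<bullet> u2 = - 1 / 2" "u0 + u1 + u2 = 0"
  shows "tangent_to_disc (convex hull {- 2 *\<^sub>R u0, - 2 *\<^sub>R u1})"
proof -
  have u2: "u2 = - u0 - u1" using assms(4) by (simp add: algebra_simps add_eq_0_iff)
  have mid: "u2 \<in> convex hull {- 2 *\<^sub>R u0, - 2 *\<^sub>R u1}"
    unfolding convex_hull_2 u2 by (intro CollectI exI[of _ "1 / 2"]) auto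
  have "affine hull {- 2 *\<^sub>R u0, - 2 *\<^sub>R u1} \<subseteq> {x. u2 \<bullet> x = 1}"
    using assms by (intro hull_minimal affine_hyperplane) (auto simp: inner_commute)
  moreover have "x = u2" if "u2 \<bullet> x = 1" "x \<in> disc" for x
  proof -
    have "(norm x)\<^sup>2 \<le> 1" using that by (simp add: power_le_one)
    then have "(x - u2) \<bullet> (x - u2) \<le> 0"
      using that assms(1) dot_square_norm[of u2]
      by (simp add: inner_diff_left inner_diff_right inner_commute power2_norm_eq_inner)
    then show ?thesis by (metis eq_iff_diff_eq_0 inner_gt_zero_iff not_le)
  qed
  moreover have "u2 \<in> affine hull {- 2 *\<^sub>R u0, - 2 *\<^sub>R u1}"
    using mid convex_hull_subset_affine_hull by blast
  ultimately have "affine hull (convex hull {- 2 *\<^sub>R u0, - 2 *\<^sub>R u1}) \<inter> disc = {u2}"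
    using assms(1) unfolding affine_hull_convex_hull by auto
  then show ?thesis unfolding tangent_to_disc_def using mid by blast
qed

lemma circumscribed_triangle_triangle: "circumscribed_triangle triangle"
  unfolding circumscribed_triangle_def
proof (intro conjI allI impI)
  have "card {- 2 *\<^sub>R v0, - 2 *\<^sub>R v1, - 2 *\<^sub>R v2} = 3" using distinct by auto
  then show "2 simplex triangle"
    unfolding triangle_def using affine_independent by (intro simplex_convex_hull) simp
  show "disc \<subseteq> triangle" by (rule disc_subset_triangle)
  fix F assume "F edge_of triangle"
  then obtain C where C: "C \<subseteq> {- 2 *\<^sub>R v0, - 2 *\<^sub>R v1, - 2 *\<^sub>R v2}" "F = convex hull C" "aff_dim C = 1"
    unfolding edge_of_def triangle_def face_of_convex_hull_affine_independent[OF affine_independent]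
    by (auto simp: aff_dim_convex_hull)
  have "\<not> affine_dependent C" using affine_dependent_subset C(1) affine_independent by blast
  then have "card C = 2" using aff_dim_affine_independent[of C] C(3) by simp
  then obtain p q where pq: "C = {p, q}" "p \<noteq> q" by (auto simp: card_2_iff)
  have sums: "v0 + v1 + v2 = 0" "v1 + v0 + v2 = 0" "v0 + v2 + v1 = 0" "v2 + v0 + v1 = 0"
    "v1 + v2 + v0 = 0" "v2 + v1 + v0 = 0"
    using sum_zero by (simp_all add: algebra_simps)
  have "tangent_to_disc (convex hull {- 2 *\<^sub>R v0, - 2 *\<^sub>R v1})"
    "tangent_to_disc (convex hull {- 2 *\<^sub>R v0, - 2 *\<^sub>R v2})"
    "tangent_to_disc (convex hull {- 2 *\<^sub>R v1, - 2 *\<^sub>R v2})"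
    using tangent_edge[of v2 v0 v1] tangent_edge[of v1 v0 v2] tangent_edge[of v0 v1 v2]
    by (simp_all add: inners unit sums)
  moreover have "C = {- 2 *\<^sub>R v0, - 2 *\<^sub>R v1} \<or> C = {- 2 *\<^sub>R v0, - 2 *\<^sub>R v2} \<or> C = {- 2 *\<^sub>R v1, - 2 *\<^sub>R v2}"
    using C(1) pq by auto
  ultimately show "tangent_to_disc F" unfolding C(2) by metis
qed

lemma contact_points_triangle: "contact_points triangle = {v0, v1, v2}"
proof -
  have eq: "triangle = {x. v0 \<bullet> x \<le> 1} \<inter> {x. v1 \<bullet> x \<le> 1} \<inter> {x. v2 \<bullet> x \<le> 1}"
    by (auto simp: mem_triangle)
  have "v0 \<noteq> 0" "v1 \<noteq> 0" "v2 \<noteq> 0" using unit by auto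
  then have int: "interior triangle = {x. v0 \<bullet> x < 1 \<and> v1 \<bullet> x < 1 \<and> v2 \<bullet> x < 1}"
    unfolding eq interior_Int by (auto simp: interior_halfspace_le)
  have "closed triangle" unfolding eq by (intro closed_Int closed_halfspace_le)
  then have fr: "frontier triangle = triangle - interior triangle" by (simp add: frontier_def)
  have touch: "v = x" if "norm v = 1" "norm x = 1" "v \<bullet> x = 1" for v x :: "real^2"
  proof -
    have "(v - x) \<bullet> (v - x) = 0"
      using that dot_square_norm[of v] dot_square_norm[of x]
      by (simp add: inner_diff_left inner_diff_right inner_commute)
    then show ?thesis by simp
  qed
  show ?thesis
  proof
    show "contact_points triangle \<subseteq> {v0, v1, v2}"
    proof
      fix x assume "x \<in> contact_points triangle"
      then have "norm x = 1" "v0 \<bullet> x = 1 \<or> v1 \<bullet> x = 1 \<or> v2 \<bullet> x = 1"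
        unfolding contact_points_def fr int by (auto simp: mem_triangle)
      then show "x \<in> {v0, v1, v2}" using touch unit by blast
    qed
    show "{v0, v1, v2} \<subseteq> contact_points triangle"
      unfolding contact_points_def fr int by (auto simp: mem_triangle inners unit)
  qed
qed

end

lemma regular_triple_dir: "regular_triple (dir t) (dir (t + 2 * pi / 3)) (dir (t - 2 * pi / 3))"
proof
  have "cos (2 * pi - 2 * pi / 3) = - 1 / 2" by (subst cos_diff) (simp add: cos_120)
  then show "dir (t + 2 * pi / 3) \<bullet> dir (t - 2 * pi / 3) = - 1 / 2" by (simp add: inner_dir)
  fix x :: "real^2"
  have v: "2 * cos (t + 2 * pi / 3) = - cos t - sqrt 3 * sin t"
    "2 * sin (t + 2 * pi / 3) = - sin t + sqrt 3 * cos t"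
    "2 * cos (t - 2 * pi / 3) = - cos t + sqrt 3 * sin t"
    "2 * sin (t - 2 * pi / 3) = - sin t - sqrt 3 * cos t"
    by (simp_all add: cos_add sin_add cos_diff sin_diff cos_120 sin_120)
  have c: "(cos t)\<^sup>2 + (sin t)\<^sup>2 = 1" "(sqrt 3)\<^sup>2 = 3" by simp_all
  have "2 * ((x \<bullet> dir t) * dir t $ 1 + (x \<bullet> dir (t + 2 * pi / 3)) * dir (t + 2 * pi / 3) $ 1
      + (x \<bullet> dir (t - 2 * pi / 3)) * dir (t - 2 * pi / 3) $ 1) = 3 * x $ 1"
    using c v unfolding inner_real2 dir_nth by algebra
  moreover have "2 * ((x \<bullet> dir t) * dir t $ 2 + (x \<bullet> dir (t + 2 * pi / 3)) * dir (t + 2 * pi / 3) $ 2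
      + (x \<bullet> dir (t - 2 * pi / 3)) * dir (t - 2 * pi / 3) $ 2) = 3 * x $ 2"
    using c v unfolding inner_real2 dir_nth by algebra
  ultimately show "(x \<bullet> dir t) *\<^sub>R dir t + (x \<bullet> dir (t + 2 * pi / 3)) *\<^sub>R dir (t + 2 * pi / 3)
      + (x \<bullet> dir (t - 2 * pi / 3)) *\<^sub>R dir (t - 2 * pi / 3) = (3 / 2) *\<^sub>R x"
    by (simp add: vec_eq_iff forall_2)
qed (simp_all add: inner_dir cos_120)

section \<open>The contact measure and its support\<close>

text \<open>A measure introduced by a set function agrees with that function only if it is countably additive;
  a finite sum of multiples of Dirac measures is.\<close>

lemma emeasure_contact_measure:
  assumes "finite (contact_points S)" "A \<in> sets circle_borel"
  shows "emeasure (contact_measure S) A = (\<Sum>v\<in>contact_points S. 2 / 3 * emeasure (return circle_borel v) A)"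
proof (rule emeasure_measure_of[OF contact_measure_def])
  show "sets circle_borel \<subseteq> Pow circle"
    using sets.space_closed[of circle_borel] by (simp add: space_restrict_space)
  have s: "sets (contact_measure S) = sets circle_borel"
    unfolding contact_measure_def
    using sets.sigma_sets_eq[of circle_borel] sets.space_closed[of circle_borel]
    by (simp add: sets_measure_of space_restrict_space)
  then show "A \<in> sets (contact_measure S)" using assms by simp
  show "positive (sets (contact_measure S)) (\<lambda>A. \<Sum>v\<in>contact_points S. 2 / 3 * emeasure (return circle_borel v) A)"
    by (simp add: positive_def)
  show "countably_additive (sets (contact_measure S))
      (\<lambda>A. \<Sum>v\<in>contact_points S. 2 / 3 * emeasure (return circle_borel v) A)"
  proof (rule countably_additiveI)
    fix B :: "nat \<Rightarrow> (real^2) set"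
    assume B: "range B \<subseteq> sets (contact_measure S)" "disjoint_family B"
    have "(\<Sum>i. \<Sum>v\<in>contact_points S. 2 / 3 * emeasure (return circle_borel v) (B i))
        = (\<Sum>v\<in>contact_points S. \<Sum>i. 2 / 3 * emeasure (return circle_borel v) (B i))"
      by (intro suminf_sum summableI)
    also have "\<dots> = (\<Sum>v\<in>contact_points S. 2 / 3 * emeasure (return circle_borel v) (\<Union>i. B i))"
      using B s by (intro sum.cong refl) (simp only: ennreal_suminf_cmult suminf_emeasure sets_return)
    finally show "(\<Sum>i. \<Sum>v\<in>contact_points S. 2 / 3 * emeasure (return circle_borel v) (B i))
        = (\<Sum>v\<in>contact_points S. 2 / 3 * emeasure (return circle_borel v) (\<Union>i. B i))" .
  qed
qed

lemma supp_contact_measure: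
  assumes "finite (contact_points S)"
  shows "supp (contact_measure S) = contact_points S"
proof -
  have sub: "contact_points S \<subseteq> circle" by (auto simp: contact_points_def)
  have sp: "space (contact_measure S) = circle"
    unfolding contact_measure_def
    using sets.space_closed[of circle_borel] by (simp add: space_measure_of space_restrict_space)
  have meas: "U \<inter> circle \<in> sets circle_borel" if "open U" for U
  proof -
    have "U \<in> sets borel" using that by simp
    then show ?thesis unfolding sets_restrict_space by blast
  qed
  have em: "emeasure (contact_measure S) (U \<inter> circle) = (\<Sum>v\<in>contact_points S. 2 / 3 * indicator U v)"
    if "open U" for U
    unfolding emeasure_contact_measure[OF assms meas[OF that]]
    using sub meas[OF that] by (intro sum.cong refl) (auto simp: indicator_def)
  show ?thesis
  proof (intro equalityI subsetI)
    fix x assume x: "x \<in> supp (contact_measure S)"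
    show "x \<in> contact_points S"
    proof (rule ccontr)
      assume n: "x \<notin> contact_points S"
      have o: "open (- contact_points S)" using assms by (intro open_Compl finite_imp_closed)
      have "emeasure (contact_measure S) (- contact_points S \<inter> circle) = 0"
        unfolding em[OF o] by simp
      then show False using x o n unfolding supp_def sp by force
    qed
  next
    fix x assume x: "x \<in> contact_points S"
    have "0 < emeasure (contact_measure S) (U \<inter> circle)" if "open U" "x \<in> U" for U
    proof -
      have "2 / 3 * indicator U x \<le> (\<Sum>v\<in>contact_points S. 2 / 3 * (indicator U v :: ennreal))"
        using x assms by (intro member_le_sum) auto
      then have "2 / 3 \<le> emeasure (contact_measure S) (U \<inter> circle)" using that em by simp
      moreover have "(0::ennreal) < 2 / 3" by (simp add: ennreal_zero_less_divide)
      ultimately show ?thesis by (rule order_less_le_trans[rotated])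
    qed
    then show "x \<in> supp (contact_measure S)" using x sub by (auto simp: supp_def sp)
  qed
qed

section \<open>The spherical Hausdorff distance\<close>

lemma angle_nonneg:
  assumes "x \<in> circle" "y \<in> circle"
  shows "0 \<le> angle x y"
  using Cauchy_Schwarz_ineq2[of x y] assms by (simp add: angle_def abs_le_iff arccos_lbound)

lemma angle_dir_le: "angle (dir s) (dir t) \<le> \<bar>s - t\<bar>"
proof (cases "\<bar>s - t\<bar> \<le> pi")
  case True
  then show ?thesis by (simp add: angle_def inner_dir arccos_cos_eq_abs)
next
  case False
  have "arccos (cos (s - t)) \<le> pi" by (intro arccos_ubound) auto
  then show ?thesis using False by (simp add: angle_def inner_dir)
qed

lemma hausdorff_dist_le:
  assumes "X \<noteq> {}" "Y \<noteq> {}" "X \<subseteq> circle" "Y \<subseteq> circle"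
    and "\<And>x. x \<in> X \<Longrightarrow> \<exists>y\<in>Y. angle x y \<le> d" "\<And>y. y \<in> Y \<Longrightarrow> \<exists>x\<in>X. angle x y \<le> d"
  shows "hausdorff_dist X Y \<le> d"
proof -
  have "(INF y\<in>Y. angle x y) \<le> d" if x: "x \<in> X" for x
  proof -
    obtain y where "y \<in> Y" "angle x y \<le> d" using assms(5) x by blast
    moreover have "bdd_below (angle x ` Y)"
      using angle_nonneg assms(3,4) x by (intro bdd_belowI2[of _ 0]) blast
    ultimately show ?thesis by (intro cINF_lower2) auto
  qed
  moreover have "(INF x\<in>X. angle x y) \<le> d" if y: "y \<in> Y" for y
  proof -
    obtain x where "x \<in> X" "angle x y \<le> d" using assms(6) y by blast
    moreover have "bdd_below ((\<lambda>x. angle x y) ` X)"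
      using angle_nonneg assms(3,4) y by (intro bdd_belowI2[of _ 0]) blast
    ultimately show ?thesis by (intro cINF_lower2) auto
  qed
  ultimately show ?thesis
    unfolding hausdorff_dist_def using assms(1,2) by (intro max.boundedI cSUP_least)
qed

section \<open>Stability\<close>

text \<open>Translates closeness of angles into Hausdorff distance to the triangle with one contact point at
  \<open>dir t\<close>. Both ends of \<open>[t, t + 2\<pi>]\<close> represent that contact point.\<close>

lemma triangle_close:
  assumes "K \<subseteq> circle"
    and near: "\<And>s. dir s \<in> K \<Longrightarrow> t \<le> s \<Longrightarrow> s \<le> t + 2 * pi \<Longrightarrow> \<bar>s - t\<bar> \<le> d \<or>
       \<bar>s - (t + 2 * pi / 3)\<bar> \<le> d \<or> \<bar>s - (t + 4 * pi / 3)\<bar> \<le> d \<or> \<bar>s - (t + 2 * pi)\<bar> \<le> d"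
    and hit: "\<exists>s. dir s \<in> K \<and> \<bar>s - t\<bar> \<le> d" "\<exists>s. dir s \<in> K \<and> \<bar>s - (t + 2 * pi / 3)\<bar> \<le> d"
      "\<exists>s. dir s \<in> K \<and> \<bar>s - (t + 4 * pi / 3)\<bar> \<le> d"
  shows "\<exists>S. regular_triangle S \<and> circumscribed_triangle S \<and>
           hausdorff_dist K (supp (contact_measure S)) \<le> d"
proof -
  interpret regular_triple "dir t" "dir (t + 2 * pi / 3)" "dir (t - 2 * pi / 3)"
    by (rule regular_triple_dir)
  have e: "dir (t - 2 * pi / 3) = dir (t + 4 * pi / 3)"
    using dir_periodic[of "t - 2 * pi / 3"] by (simp add: algebra_simps)
  let ?V = "{dir t, dir (t + 2 * pi / 3), dir (t + 4 * pi / 3)}"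
  have cp: "contact_points triangle = ?V" using contact_points_triangle by (simp only: e)
  then have V: "supp (contact_measure triangle) = ?V" using supp_contact_measure[of triangle] by simp
  have "hausdorff_dist K ?V \<le> d"
  proof (rule hausdorff_dist_le)
    show "K \<noteq> {}" using hit(1) by auto
    show "\<exists>y\<in>?V. angle x y \<le> d" if x: "x \<in> K" for x
    proof -
      obtain s where s: "t \<le> s" "s < t + 2 * pi" "x = dir s"
        using circle_direction[of x t] x assms(1) by blast
      from near[of s] s x consider "\<bar>s - t\<bar> \<le> d" | "\<bar>s - (t + 2 * pi / 3)\<bar> \<le> d"
        | "\<bar>s - (t + 4 * pi / 3)\<bar> \<le> d" | "\<bar>s - (t + 2 * pi)\<bar> \<le> d" by fastforce
      then show ?thesis
      proof cases
        case 1 then show ?thesis using angle_dir_le[of s t] s by force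
      next
        case 2 then show ?thesis using angle_dir_le[of s "t + 2 * pi / 3"] s by force
      next
        case 3 then show ?thesis using angle_dir_le[of s "t + 4 * pi / 3"] s by force
      next
        case 4 then show ?thesis using angle_dir_le[of s "t + 2 * pi"] s by force
      qed
    qed
    show "\<exists>x\<in>K. angle x y \<le> d" if y: "y \<in> ?V" for y
    proof -
      obtain s u where "y = dir u" "dir s \<in> K" "\<bar>s - u\<bar> \<le> d" using y hit by blast
      then show ?thesis using angle_dir_le[of s u] by force
    qed
  qed (use assms(1) in auto)
  then show ?thesis
    unfolding V[symmetric] using regular_triangle_triangle circumscribed_triangle_triangle by blast
qed

context gaps_at_most_third
begin

text \<open>If \<open>32 \<epsilon> \<ge> \<pi>/3\<close> there is nothing to choose: every point of the circle is within \<open>\<pi>/3\<close> of a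
  contact point of any regular triangle around the disc, and within \<open>\<pi>/3\<close> of \<open>K\<close> since the gaps are short. Otherwise
  the dichotomy for gaps applies with a small \<open>\<epsilon>\<close>. The triangle is anchored at the beginning \<open>t\<close> of a
  pair of directions of \<open>K\<close> that are nearly \<open>2\<pi>/3\<close> apart: this keeps
  the coarser alternative of the dichotomy, with its error \<open>28 \<epsilon>\<close>, from entering twice in
  the opposite third of the circle.\<close>

lemma regular_triangle_close:
  assumes "K \<subseteq> circle" "0 \<le> \<epsilon>"
    and area: "(1 - \<epsilon>) * (3 * sqrt 3) \<le> measure lborel (polar_body K)"
  shows "\<exists>S. regular_triangle S \<and> circumscribed_triangle S \<and>
           hausdorff_dist K (supp (contact_measure S)) \<le> 32 * \<epsilon>"
proof (cases "pi / 3 \<le> 32 * \<epsilon>")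
  case True
  have hit: "\<exists>s. dir s \<in> K \<and> \<bar>s - u\<bar> \<le> 32 * \<epsilon>" for u
  proof -
    obtain s where "u - pi / 3 < s" "s \<le> u - pi / 3 + 2 * pi / 3" "dir s \<in> K" using gap by blast
    then show ?thesis using True by (intro exI[of _ s]) (auto simp: abs_le_iff)
  qed
  show ?thesis
    using assms(1)
  proof (rule triangle_close[of _ 0])
    fix s :: real assume "0 \<le> s" "s \<le> 0 + 2 * pi"
    then show "\<bar>s - 0\<bar> \<le> 32 * \<epsilon> \<or> \<bar>s - (0 + 2 * pi / 3)\<bar> \<le> 32 * \<epsilon> \<or>
      \<bar>s - (0 + 4 * pi / 3)\<bar> \<le> 32 * \<epsilon> \<or> \<bar>s - (0 + 2 * pi)\<bar> \<le> 32 * \<epsilon>"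
      using True by linarith
  qed (rule hit)+
next
  case False
  note dichotomy = gap_dichotomy[OF _ _ _ _ area]
  obtain t p where tp: "dir t \<in> K" "dir p \<in> K" "t + 2 * pi / 3 - 10 * \<epsilon> \<le> p" "p \<le> t + 2 * pi / 3"
  proof -
    obtain x where x: "dir x \<in> K" using gap by blast
    then obtain y z where yz: "dir y \<in> K" "dir z \<in> K" "x \<le> y" "y \<le> x + 2 * pi / 3"
      "x + 2 * pi / 3 < z" "z \<le> y + 2 * pi / 3"
      using two_steps by metis
    show ?thesis
    proof (cases "x + 2 * pi / 3 - 10 * \<epsilon> \<le> y")
      case True
      then show ?thesis using that x yz by blast
    next
      case f: False
      then have "y - x \<le> 28 * \<epsilon>" using dichotomy[of x y] x yz by linarith
      moreover have "z - y \<le> 28 * \<epsilon> \<or> 2 * pi / 3 - 10 * \<epsilon> \<le> z - y"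
        using dichotomy[of y z] yz by linarith
      \<comment> \<open>Two short steps would advance by at most \<open>56 \<epsilon> < 2\<pi>/3\<close>, short of \<open>z\<close>.\<close>
      ultimately have "y + 2 * pi / 3 - 10 * \<epsilon> \<le> z" using yz False by linarith
      then show ?thesis using that yz by blast
    qed
  qed
  have near: "\<bar>s - t\<bar> \<le> 28 * \<epsilon> \<or> \<bar>s - (t + 2 * pi / 3)\<bar> \<le> 28 * \<epsilon> \<or>
      \<bar>s - (t + 4 * pi / 3)\<bar> \<le> 28 * \<epsilon> \<or> \<bar>s - (t + 2 * pi)\<bar> \<le> 28 * \<epsilon>"
    if s: "dir s \<in> K" "t \<le> s" "s \<le> t + 2 * pi" for s
  proof -
    consider "s \<le> t + 2 * pi / 3" | "t + 4 * pi / 3 \<le> s" | "t + 2 * pi / 3 < s" "s < t + 4 * pi / 3"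
      by linarith
    then show ?thesis
    proof cases
      case 1
      then show ?thesis using dichotomy[of t s] s tp assms(2) by (auto simp: abs_le_iff)
    next
      case 2
      then show ?thesis
        using dichotomy[of s "t + 2 * pi"] s tp assms(2) by (auto simp: abs_le_iff)
    next
      case 3
      \<comment> \<open>A step longer than \<open>2\<pi>/3\<close> falls under the second alternative, without the dichotomy.\<close>
      have "s - p \<le> 28 * \<epsilon> \<or> 2 * pi / 3 - 10 * \<epsilon> \<le> s - p"
        using dichotomy[of p s] s tp 3 assms(2) by linarith
      then show ?thesis using 3 tp assms(2) by linarith
    qed
  qed
  show ?thesis
    using assms(1)
  proof (rule triangle_close)
    show "\<exists>s. dir s \<in> K \<and> \<bar>s - t\<bar> \<le> 32 * \<epsilon>" using tp assms(2) by (intro exI[of _ t]) auto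
    show "\<exists>s. dir s \<in> K \<and> \<bar>s - (t + 2 * pi / 3)\<bar> \<le> 32 * \<epsilon>"
      using tp assms(2) by (intro exI[of _ p]) auto
    \<comment> \<open>The arc starts beyond everything near \<open>t + 2\<pi>/3\<close>, so a direction found in it can only be
      near \<open>t + 4\<pi>/3\<close>.\<close>
    obtain s where s: "t + 2 * pi / 3 + 32 * \<epsilon> < s" "s \<le> t + 2 * pi / 3 + 32 * \<epsilon> + 2 * pi / 3" "dir s \<in> K"
      using gap by blast
    have "\<bar>s - (t + 4 * pi / 3)\<bar> \<le> 32 * \<epsilon>"
    proof (cases "t + 4 * pi / 3 \<le> s")
      case True
      then show ?thesis using s by (simp add: abs_le_iff)
    next
      case f: False
      then show ?thesis using near[of s] s assms(2) False by linarith
    qed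
    then show "\<exists>s. dir s \<in> K \<and> \<bar>s - (t + 4 * pi / 3)\<bar> \<le> 32 * \<epsilon>" using s by blast
  next
    fix s assume "dir s \<in> K" "t \<le> s" "s \<le> t + 2 * pi"
    from near[OF this] show "\<bar>s - t\<bar> \<le> 32 * \<epsilon> \<or> \<bar>s - (t + 2 * pi / 3)\<bar> \<le> 32 * \<epsilon> \<or>
      \<bar>s - (t + 4 * pi / 3)\<bar> \<le> 32 * \<epsilon> \<or> \<bar>s - (t + 2 * pi)\<bar> \<le> 32 * \<epsilon>"
      using assms(2) by linarith
  qed
qed

end

theorem theorem1p6:
  fixes \<mu> :: "(real^2) measure" and \<epsilon> :: real and T :: "(real^2) set"
  assumes "sets \<mu> = sets circle_borel"
    and "centred \<mu>" and "isotropic \<mu>"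
    and "0 \<le> \<epsilon>" and "\<epsilon> < 1"
    and "regular_triangle T" and "circumscribed_triangle T"
    and "area (Z \<mu>) \<ge> (1 - \<epsilon>) * area T"
  shows "\<exists>S. regular_triangle S \<and> circumscribed_triangle S \<and>
           hausdorff_dist (supp \<mu>) (supp (contact_measure S)) \<le> 32 * \<epsilon>"
proof -
  interpret gaps_at_most_third "supp \<mu>"
    using closed_supp support_gap assms(1-3) by unfold_locales
  have "3 * sqrt 3 \<le> area T"
    using assms(6,7) area_circumscribed_ge unfolding circumscribed_triangle_def by blast
  then have "(1 - \<epsilon>) * (3 * sqrt 3) \<le> (1 - \<epsilon>) * area T"
    using assms(5) by (intro mult_left_mono) auto
  also have "\<dots> \<le> area (polar_body (supp \<mu>))"
    using assms(8) by (simp add: Z_def polar_body_def)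
  finally show ?thesis
    using assms(1,4) space_circle_measure
    by (intro regular_triangle_close) (auto simp: supp_def)
qed

end
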